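(* Let $(H,d)$ be a Hadamard space that is separable and Hausdorff with respect to the weak topology $\tau_w$. If $K\subseteq H$ is bounded, then $K$ is weakly compact if and only if $K$ is weakly sequentially compact.
   Context: A Hadamard space is a complete $\mathrm{CAT}(0)$ space. Separability and boundedness refer to the metric $d$. For $x\in H$, $\Gamma_x(H)$ is the set of all constant speed geodesics $\gamma:[0,1]\to H$ (i.e. $d(\gamma(s),\gamma(t))=|s-t|\,d(\gamma(0),\gamma(1))$ for all $s,t\in[0,1]$) with $\gamma(0)=x$. For a geodesic $\gamma$, $P_\gamma$ denotes the metric projection onto (the image of) $\gamma$. Weak convergence: $x_n\overset{w}\to x$ means $P_\gamma x_n\to x$ in the metric $d$ for every $\gamma\in\Gamma_x(H)$ (no boundedness of $(x_n)$ is required). For $x\in H$, $\gamma_1,\dots,\gamma_n\in\Gamma_x(H)$, $\varepsilon>0$, let $U_x(\varepsilon;\gamma_1,\dots,\gamma_n):=\{y\in H: d(x,P_{\gamma_i}y)<\varepsilon,\ i=1,\dots,n\}$. Weak topology $\tau_w$: a set $U\subset H$ is weakly open if for every $x\in U$ there exist $\varepsilon>0$ and finitely many $\gamma_1,\dots,\gamma_n\in\Gamma_x(H)$ with $U_x(\varepsilon;\gamma_1,\dots,\gamma_n)\subseteq U$. The weakly open sets (together with $\emptyset$) form the topology $\tau_w$ on $H$. A set $K\subseteq H$ is weakly sequentially compact if every sequence in $K$ has a subsequence converging weakly to a point of $K$. $K$ is weakly compact if every cover of $K$ by sets from $\tau_w$ has a finite subcover. *)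

theory Defs
  imports "HOL-Analysis.Analysis"
begin

text \<open>Geodesics are total functions on \<^typ>\<open>real\<close>; only their values on \<open>{0..1}\<close> matter.\<close>

definition const_speed_geodesic :: "(real \<Rightarrow> 'a::metric_space) \<Rightarrow> bool" where
  "const_speed_geodesic g \<longleftrightarrow>
     (\<forall>s\<in>{0..1}. \<forall>t\<in>{0..1}. dist (g s) (g t) = \<bar>s - t\<bar> * dist (g 0) (g 1))"

definition geodesics_from :: "'a::metric_space \<Rightarrow> (real \<Rightarrow> 'a) set" where
  "geodesics_from x = {g. const_speed_geodesic g \<and> g 0 = x}"

text \<open>
  The CAT(0) condition says that geodesic triangles are no thicker than their comparison
  triangles in the Euclidean plane. Two points of a geodesic triangle lie on a common side,
  where the distances agree anyway, or on two sides that share a vertex. Hence, up to relabelling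
  the vertices, it suffices to state the comparison for points on the sides \<open>g\<close> (from \<open>x\<close> to \<open>y\<close>)
  and \<open>h\<close> (from \<open>x\<close> to \<open>z\<close>); a third side from \<open>y\<close> to \<open>z\<close> always exists in a geodesic space.
\<close>

class hadamard_space = complete_space +
  assumes geodesic_exists:
    "\<exists>g. const_speed_geodesic g \<and> g 0 = x \<and> g 1 = y"
  and comparison_triangle:
    "\<lbrakk>const_speed_geodesic g; g 0 = x; g 1 = y;
      const_speed_geodesic h; h 0 = x; h 1 = z;
      dist X Y = dist x y; dist X Z = dist x z; dist Y Z = dist y z;
      s \<in> {0..1}; t \<in> {0..1}\<rbrakk>
     \<Longrightarrow> dist (g s) (h t) \<le> dist (X + s *\<^sub>R (Y - X)) (X + t *\<^sub>R (Z - X :: real ^ 2))"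

text \<open>
  Metric projection onto the image of a geodesic: the nearest point, which exists and is unique
  in a Hadamard space.
\<close>

definition geodesic_proj :: "(real \<Rightarrow> 'a::metric_space) \<Rightarrow> 'a \<Rightarrow> 'a" where
  "geodesic_proj g y = arg_min_on (dist y) (g ` {0..1})"

definition weakly_converges :: "(nat \<Rightarrow> 'a::metric_space) \<Rightarrow> 'a \<Rightarrow> bool" where
  "weakly_converges f x \<longleftrightarrow> (\<forall>g\<in>geodesics_from x. (\<lambda>n. geodesic_proj g (f n)) \<longlonglongrightarrow> x)"

definition weak_nbhd :: "'a::metric_space \<Rightarrow> real \<Rightarrow> (real \<Rightarrow> 'a) set \<Rightarrow> 'a set" where
  "weak_nbhd x \<epsilon> G = {y. \<forall>g\<in>G. dist x (geodesic_proj g y) < \<epsilon>}"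

definition weakly_open :: "'a::metric_space set \<Rightarrow> bool" where
  "weakly_open U \<longleftrightarrow>
     (\<forall>x\<in>U. \<exists>\<epsilon>>0. \<exists>G. finite G \<and> G \<noteq> {} \<and> G \<subseteq> geodesics_from x \<and> weak_nbhd x \<epsilon> G \<subseteq> U)"

definition weak_topology :: "'a::metric_space topology" where
  "weak_topology = topology weakly_open"

definition weakly_seq_compact :: "'a::metric_space set \<Rightarrow> bool" where
  "weakly_seq_compact K \<longleftrightarrow>
     (\<forall>f::nat \<Rightarrow> 'a. range f \<subseteq> K \<longrightarrow>
        (\<exists>l\<in>K. \<exists>r::nat \<Rightarrow> nat. strict_mono r \<and> weakly_converges (f \<circ> r) l))"

lemma istopology_weakly_open: "istopology (weakly_open :: 'a::metric_space set \<Rightarrow> bool)"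
  unfolding istopology_def
proof (intro conjI allI impI)
  fix S T :: "'a set"
  assume S: "weakly_open S" and T: "weakly_open T"
  show "weakly_open (S \<inter> T)"
    unfolding weakly_open_def
  proof
    fix x assume x: "x \<in> S \<inter> T"
    obtain d G where G: "d > 0" "finite G" "G \<noteq> {}" "G \<subseteq> geodesics_from x" "weak_nbhd x d G \<subseteq> S"
      using S x unfolding weakly_open_def by (meson IntD1)
    obtain e F where F: "e > 0" "finite F" "F \<subseteq> geodesics_from x" "weak_nbhd x e F \<subseteq> T"
      using T x unfolding weakly_open_def by (meson IntD2)
    have "weak_nbhd x (min d e) (G \<union> F) \<subseteq> S \<inter> T"
      using G(5) F(4) unfolding weak_nbhd_def by auto
    then show "\<exists>\<epsilon>>0. \<exists>H. finite H \<and> H \<noteq> {} \<and> H \<subseteq> geodesics_from x \<and> weak_nbhd x \<epsilon> H \<subseteq> S \<inter> T"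
      using G F by (intro exI[of _ "min d e"] conjI exI[of _ "G \<union> F"]) auto
  qed
next
  fix \<K> :: "'a set set"
  assume "\<forall>K\<in>\<K>. weakly_open K"
  then show "weakly_open (\<Union>\<K>)"
    unfolding weakly_open_def by (meson Union_iff Union_upper subset_trans)
qed

lemma openin_weak_topology [simp]: "openin weak_topology U \<longleftrightarrow> weakly_open U"
  by (simp add: weak_topology_def istopology_weakly_open topology_inverse')

lemma topspace_weak_topology [simp]: "topspace (weak_topology :: 'a::metric_space topology) = UNIV"
proof -
  have const: "(\<lambda>_. x) \<in> geodesics_from x" for x :: 'a
    by (simp add: geodesics_from_def const_speed_geodesic_def)
  have "weakly_open (UNIV :: 'a set)"
    unfolding weakly_open_def
  proof
    fix x :: 'a
    show "\<exists>\<epsilon>>0. \<exists>G. finite G \<and> G \<noteq> {} \<and> G \<subseteq> geodesics_from x \<and> weak_nbhd x \<epsilon> G \<subseteq> UNIV"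
      using const[of x] by (intro exI[of _ 1] conjI exI[of _ "{\<lambda>_. x}"]) auto
  qed
  then show ?thesis
    using openin_subset[of weak_topology UNIV] by auto
qed

end

theory Submission
  imports Defs
begin

text \<open>
  If \<open>K\<close> is weakly sequentially compact, then it is compact because it has the Lindelof property,
  which turns sequential compactness into compactness. The projection of \<open>y\<close> to a geodesic issuing
  from \<open>x\<close> stays close to \<open>x\<close> when \<open>y\<close> does, so weakly open sets are open for the metric
  (\<open>weakly_open_imp_open\<close>), and in a separable metric space every cover by open sets has a countable
  subcover. If no finite part of a countable weakly open cover sufficed, then a sequence in \<open>K\<close> that
  leaves the finite unions one after the other would have a subsequence converging weakly in \<open>K\<close>; its
  limit lies in some member of the cover, which must contain the subsequence eventually.

  If \<open>K\<close> is weakly compact, it is weakly closed by the Hausdorff property. So it suffices that every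
  bounded sequence has a weakly convergent subsequence
  (\<open>bounded_imp_weakly_convergent_subsequence\<close>): for a sequence in \<open>K\<close>, the limit cannot lie in the
  weakly open complement of \<open>K\<close>. To find the subsequence, choose it such that
  \<open>\<psi> y = lim dist (x n) y\<close> exists for every \<open>y\<close>, which is a diagonal argument over a countable dense
  set. The CAT(0) inequality makes \<open>\<psi>\<^sup>2\<close> uniformly convex, so by completeness it has a unique
  minimiser \<open>l\<close>, the asymptotic centre. Let \<open>p\<close> be a limit point of the projections of \<open>x n\<close> to a
  geodesic from \<open>l\<close>. Since a projection is a nearest point, \<open>\<psi> p \<le> \<psi> l\<close> and thus \<open>p = l\<close>; as the
  geodesic is compact, the projections converge to \<open>l\<close>.
\<close>

section \<open>The CAT(0) inequality for midpoints\<close>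

lemma ex_comparison_triangle:
  fixes a b c :: real
  assumes "0 \<le> a" "0 \<le> b" "0 \<le> c" "a \<le> b + c" "b \<le> a + c" "c \<le> a + b"
  shows "\<exists>Y Z X :: real ^ 2. dist Y Z = a \<and> dist Y X = b \<and> dist Z X = c"
proof (cases "a = 0")
  case True
  then have "b = c" using assms by auto
  have "dist (0::real^2) (vector [b, 0]) = b"
    using assms by (simp add: dist_norm norm_vec_def L2_set_def sum_2)
  then show ?thesis using True \<open>b = c\<close> by (intro exI[of _ 0] exI[of _ "vector [b, 0]"]) auto
next
  case False
  then have a: "a > 0" using assms by simp
  \<comment> \<open>The first two vertices are \<open>0\<close> and \<open>(a, 0)\<close>. The law of cosines forces the first coordinate
    \<open>u\<close> of the third; the triangle inequalities give \<open>\<bar>u\<bar> \<le> b\<close>, so that \<open>v\<close> is a real root.\<close>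
  define u where "u = (a\<^sup>2 + b\<^sup>2 - c\<^sup>2) / (2 * a)"
  define v where "v = sqrt (b\<^sup>2 - u\<^sup>2)"
  have au: "2 * a * u = a\<^sup>2 + b\<^sup>2 - c\<^sup>2" using a by (simp add: u_def)
  have "c\<^sup>2 \<le> (a + b)\<^sup>2" "(a - b)\<^sup>2 \<le> c\<^sup>2" using assms by (auto simp: power_mono abs_le_square_iff[symmetric])
  then have "a * u \<le> a * b" "a * (- b) \<le> a * u"
    using au by (auto simp: power2_eq_square algebra_simps)
  then have "u \<le> b" "- b \<le> u" using a by (simp_all only: mult_le_cancel_left_pos)
  then have "\<bar>u\<bar> \<le> b" by linarith
  then have "u\<^sup>2 \<le> b\<^sup>2" by (metis abs_le_square_iff abs_of_nonneg assms(2))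
  then have v: "v\<^sup>2 = b\<^sup>2 - u\<^sup>2" by (simp add: v_def)
  have "dist (0::real^2) (vector [a, 0]) = a"
    using a by (simp add: dist_norm norm_vec_def L2_set_def sum_2)
  moreover have "dist (0::real^2) (vector [u, v]) = b"
    using assms v by (simp add: dist_norm norm_vec_def L2_set_def sum_2)
  moreover have "(a - u)\<^sup>2 + v\<^sup>2 = c\<^sup>2"
    using v au by (simp add: power2_eq_square algebra_simps)
  then have "dist (vector [a, 0] :: real^2) (vector [u, v]) = c"
    using assms by (simp add: dist_norm norm_vec_def L2_set_def sum_2)
  ultimately show ?thesis by blast
qed

text \<open>
  The inequality of Bruhat and Tits. In the plane it is an equality, the parallelogram law for the
  median from \<open>x\<close>; comparison of the triangle's median with the planar one gives the upper bound.
\<close>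

lemma ex_midpoint_CN:
  fixes y z :: "'h::hadamard_space"
  shows "\<exists>m. \<forall>x. (dist x m)\<^sup>2 \<le> (dist x y)\<^sup>2 / 2 + (dist x z)\<^sup>2 / 2 - (dist y z)\<^sup>2 / 4"
proof -
  obtain g where g: "const_speed_geodesic g" "g 0 = y" "g 1 = z"
    using geodesic_exists by blast
  have "(dist x (g (1/2)))\<^sup>2 \<le> (dist x y)\<^sup>2 / 2 + (dist x z)\<^sup>2 / 2 - (dist y z)\<^sup>2 / 4" for x
  proof -
    obtain h where h: "const_speed_geodesic h" "h 0 = y" "h 1 = x"
      using geodesic_exists by blast
    obtain Y Z X :: "real ^ 2" where T: "dist Y Z = dist y z" "dist Y X = dist y x" "dist Z X = dist z x"
      using ex_comparison_triangle[of "dist y z" "dist y x" "dist z x"]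
      using dist_triangle[of y z x] dist_triangle[of y x z] dist_triangle[of z x y]
      by (auto simp: dist_commute)
    have "dist (g (1/2)) (h 1) \<le> dist (Y + (1/2) *\<^sub>R (Z - Y)) (Y + 1 *\<^sub>R (X - Y))"
      using g h T by (intro comparison_triangle) auto
    then have "dist x (g (1/2)) \<le> norm ((1/2) *\<^sub>R (Z - Y) - (X - Y))"
      by (simp add: h dist_commute dist_norm norm_minus_commute algebra_simps)
    then have "(dist x (g (1/2)))\<^sup>2 \<le> (norm ((1/2) *\<^sub>R (Z - Y) - (X - Y)))\<^sup>2"
      by (simp add: power_mono)
    also have "\<dots> = (norm (Y - X))\<^sup>2 / 2 + (norm (Z - X))\<^sup>2 / 2 - (norm (Y - Z))\<^sup>2 / 4"
      unfolding power2_norm_eq_inner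
      by (simp add: inner_simps inner_commute field_simps)
    finally show ?thesis
      using T by (simp add: dist_norm[symmetric] dist_commute)
  qed
  then show ?thesis by blast
qed

section \<open>Projections to geodesics and the weak topology\<close>

lemma compact_geodesic_image:
  assumes "const_speed_geodesic g"
  shows "compact (g ` {0..1})"
proof (rule compact_continuous_image)
  have "dist (g s) (g t) \<le> dist (g 0) (g 1) * dist s t" if "s \<in> {0..1}" "t \<in> {0..1}" for s t
  proof -
    have "dist (g s) (g t) = \<bar>s - t\<bar> * dist (g 0) (g 1)"
      using assms that unfolding const_speed_geodesic_def by blast
    then show ?thesis by (simp only: dist_real_def mult.commute order.refl)
  qed
  then have "(dist (g 0) (g 1))-lipschitz_on {0..1} g"
    by (intro lipschitz_onI) auto
  then show "continuous_on {0..1} g" by (rule lipschitz_on_continuous_on)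
qed auto

text \<open>
  The projection is defined by choice of a minimiser; compactness of the geodesic ensures that there
  is one to choose.
\<close>

lemma geodesic_proj_nearest:
  assumes "const_speed_geodesic g"
  shows "geodesic_proj g y \<in> g ` {0..1}"
    and "\<And>p. p \<in> g ` {0..1} \<Longrightarrow> dist y (geodesic_proj g y) \<le> dist y p"
proof -
  have "\<exists>p\<in>g ` {0..1}. \<forall>q\<in>g ` {0..1}. dist y p \<le> dist y q"
    by (rule continuous_attains_inf)
      (auto intro!: continuous_intros compact_geodesic_image[OF assms])
  then have "\<exists>p. is_arg_min (dist y) (\<lambda>p. p \<in> g ` {0..1}) p"
    unfolding is_arg_min_linorder by blast
  then have "is_arg_min (dist y) (\<lambda>p. p \<in> g ` {0..1}) (geodesic_proj g y)"
    unfolding geodesic_proj_def arg_min_on_def arg_min_def by (rule someI_ex)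
  then have *: "geodesic_proj g y \<in> g ` {0..1}"
    "\<forall>p. p \<in> g ` {0..1} \<longrightarrow> dist y (geodesic_proj g y) \<le> dist y p"
    unfolding is_arg_min_linorder by simp_all
  show "geodesic_proj g y \<in> g ` {0..1}" by (rule *)
  show "dist y (geodesic_proj g y) \<le> dist y p" if "p \<in> g ` {0..1}" for p
    using *(2) that by blast
qed

lemma geodesics_fromD:
  assumes "g \<in> geodesics_from x"
  shows "const_speed_geodesic g" "x \<in> g ` {0..1}"
proof -
  have g: "const_speed_geodesic g" "x = g 0" using assms by (simp_all add: geodesics_from_def)
  then show "const_speed_geodesic g" by blast
  show "x \<in> g ` {0..1}" unfolding g(2) by (rule imageI) simp
qed

text \<open>
  As \<open>x\<close> itself lies on the geodesics in \<open>G\<close>, the projection of \<open>y\<close> is at distance at most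
  \<open>dist y x\<close> from \<open>y\<close>, hence at most twice that from \<open>x\<close>; this explains the radius \<open>e / 2\<close>.
\<close>

lemma ball_subset_weak_nbhd:
  assumes "G \<subseteq> geodesics_from x"
  shows "ball x (e / 2) \<subseteq> weak_nbhd x e G"
proof -
  have "dist x (geodesic_proj g y) < e" if "dist x y < e / 2" "g \<in> G" for y g
  proof -
    have "g \<in> geodesics_from x" using assms that by blast
    then have "dist y (geodesic_proj g y) \<le> dist y x"
      by (intro geodesic_proj_nearest(2) geodesics_fromD)
    then show ?thesis
      using that dist_triangle[of x "geodesic_proj g y" y] by (simp add: dist_commute)
  qed
  then show ?thesis by (auto simp: weak_nbhd_def)
qed

lemma weakly_open_imp_open:
  assumes "weakly_open U"
  shows "open U"
  unfolding open_contains_ball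
proof
  fix x assume "x \<in> U"
  then obtain e G where "e > 0" "G \<subseteq> geodesics_from x" "weak_nbhd x e G \<subseteq> U"
    using assms unfolding weakly_open_def by blast
  then show "\<exists>e>0. ball x e \<subseteq> U"
    using ball_subset_weak_nbhd[of G x e] by (intro exI[of _ "e / 2"]) auto
qed

text \<open>
  Weak convergence, which is defined by projections, implies convergence in the weak topology,
  because a weak neighbourhood constrains only finitely many projections.
\<close>

lemma weakly_converges_eventually_in:
  assumes "weakly_converges f l" "weakly_open U" "l \<in> U"
  shows "\<forall>\<^sub>F n in sequentially. f n \<in> U"
proof -
  obtain e G where G: "e > 0" "finite G" "G \<subseteq> geodesics_from l" "weak_nbhd l e G \<subseteq> U"
    using assms(2,3) unfolding weakly_open_def by blast
  have "\<forall>\<^sub>F n in sequentially. dist l (geodesic_proj g (f n)) < e" if "g \<in> G" for g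
  proof -
    have "(\<lambda>n. geodesic_proj g (f n)) \<longlonglongrightarrow> l"
      using assms(1) G(3) that unfolding weakly_converges_def by blast
    then show ?thesis using \<open>e > 0\<close> by (simp add: tendsto_iff dist_commute)
  qed
  then have "\<forall>\<^sub>F n in sequentially. \<forall>g\<in>G. dist l (geodesic_proj g (f n)) < e"
    using G(2) by (simp add: eventually_ball_finite_distrib)
  then show ?thesis
    by (rule eventually_mono) (use G(4) in \<open>auto simp: weak_nbhd_def\<close>)
qed

section \<open>Weakly sequentially compact sets are weakly compact\<close>

lemma separable_metric_dense_set:
  assumes "separable_space (euclidean :: 'a::metric_space topology)"
  obtains D :: "'a::metric_space set" where "countable D" "\<And>x e. e > 0 \<Longrightarrow> \<exists>q\<in>D. dist x q < e"
proof -
  obtain D :: "'a set" where D: "countable D" "euclidean closure_of D = UNIV"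
    using assms unfolding separable_space_def by auto
  have "\<exists>q\<in>D. dist x q < e" if "e > 0" for x e
  proof -
    have "x \<in> euclidean closure_of D" using D by simp
    then have "\<forall>T. x \<in> T \<and> open T \<longrightarrow> (\<exists>q\<in>D. q \<in> T)"
      unfolding in_closure_of by (simp add: Bex_def)
    then have "\<exists>q\<in>D. q \<in> ball x e" using that by (meson centre_in_ball open_ball)
    then show ?thesis by auto
  qed
  then show ?thesis using D that by blast
qed

lemma separable_metric_imp_second_countable:
  assumes "separable_space (euclidean :: 'a::metric_space topology)"
  shows "second_countable (euclidean :: 'a::metric_space topology)"
proof -
  obtain D :: "'a set" where D: "countable D" "\<And>x e. e > 0 \<Longrightarrow> \<exists>q\<in>D. dist x q < e"
    using separable_metric_dense_set[OF assms] by blast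
  define B where "B = (\<lambda>(q, n). ball q (1 / real (Suc n))) ` (D \<times> UNIV)"
  have "\<exists>V\<in>B. x \<in> V \<and> V \<subseteq> U" if "open U" "x \<in> U" for U x
  proof -
    obtain e where e: "e > 0" "ball x e \<subseteq> U"
      using \<open>open U\<close> \<open>x \<in> U\<close> open_contains_ball by blast
    obtain n where n: "1 / real (Suc n) < e / 2"
      using e nat_approx_posE[of "e / 2"] by auto
    obtain q where q: "q \<in> D" "dist x q < 1 / real (Suc n)"
      using D(2)[of "1 / real (Suc n)" x] by auto
    have "dist x y < e" if "dist q y < 1 / real (Suc n)" for y
      using dist_triangle[of x y q] that q n by linarith
    then have "ball q (1 / real (Suc n)) \<subseteq> U" using e(2) by auto
    moreover have "x \<in> ball q (1 / real (Suc n))" using q by (simp add: dist_commute)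
    moreover have "ball q (1 / real (Suc n)) \<in> B"
      unfolding B_def using q(1) by (intro image_eqI[of _ _ "(q, n)"]) auto
    ultimately show ?thesis by blast
  qed
  moreover have "countable B" using D(1) by (simp add: B_def)
  moreover have "\<forall>V\<in>B. open V" by (auto simp: B_def)
  ultimately show ?thesis
    unfolding second_countable_def open_openin[symmetric] by blast
qed

text \<open>
  The metric topology is hereditarily Lindelof and finer than the weak one, so only countable covers
  matter, and for these the usual argument with a sequence avoiding ever more members applies.
\<close>

lemma weakly_seq_compact_imp_compactin:
  fixes K :: "'a::metric_space set"
  assumes sep: "separable_space (euclidean :: 'a topology)"
    and K: "weakly_seq_compact K"
  shows "compactin weak_topology K"
  unfolding compactin_def
proof (intro conjI allI impI)
  fix \<U> :: "'a set set"
  assume "(\<forall>U\<in>\<U>. openin weak_topology U) \<and> K \<subseteq> \<Union>\<U>"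
  then have \<U>: "\<And>U. U \<in> \<U> \<Longrightarrow> weakly_open U" "K \<subseteq> \<Union>\<U>" by auto
  have "Lindelof_space (subtopology euclidean K)"
    by (intro second_countable_imp_Lindelof_space second_countable_subtopology
        separable_metric_imp_second_countable sep)
  then obtain \<V> where \<V>: "countable \<V>" "\<V> \<subseteq> \<U>" "K \<subseteq> \<Union>\<V>"
    using \<U> weakly_open_imp_open
    unfolding Lindelof_space_subtopology_subset[OF subset_UNIV[of K, folded topspace_euclidean]]
    by (metis open_openin)
  show "\<exists>\<F>. finite \<F> \<and> \<F> \<subseteq> \<U> \<and> K \<subseteq> \<Union>\<F>"
  proof (cases "\<V> = {}")
    case True
    then show ?thesis using \<V> by (intro exI[of _ "{}"]) auto
  next
    case False
    define V where "V = from_nat_into \<V>"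
    have V: "range V = \<V>" using False \<V>(1) by (simp add: V_def)
    show ?thesis
    proof (rule ccontr)
      assume no: "\<not> ?thesis"
      have "\<exists>x. x \<in> K \<and> x \<notin> \<Union>(V ` {..n})" for n
      proof -
        have "finite (V ` {..n})" "V ` {..n} \<subseteq> \<U>" using V \<V>(2) by auto
        then show ?thesis using no by blast
      qed
      then obtain f where f: "\<And>n. f n \<in> K" "\<And>n. f n \<notin> \<Union>(V ` {..n})" by metis
      then have "range f \<subseteq> K" by blast
      then obtain l r where l: "l \<in> K" "strict_mono r" "weakly_converges (f \<circ> r) l"
        using K unfolding weakly_seq_compact_def by meson
      obtain m where m: "l \<in> V m" using l(1) \<V>(3) V by blast
      have "weakly_open (V m)" using V \<V>(2) \<U>(1) by blast
      then have "\<forall>\<^sub>F n in sequentially. (f \<circ> r) n \<in> V m"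
        using weakly_converges_eventually_in[OF l(3)] m by blast
      then have "\<forall>\<^sub>F n in sequentially. (f \<circ> r) n \<in> V m \<and> m \<le> n"
        by (intro eventually_conj eventually_ge_at_top)
      then obtain n where "f (r n) \<in> V m" "m \<le> n"
        using eventually_happens'[OF sequentially_bot] by fastforce
      moreover have "m \<le> r n" using \<open>m \<le> n\<close> seq_suble[OF l(2), of n] by simp
      ultimately show False using f(2)[of "r n"] by auto
    qed
  qed
qed simp

section \<open>Bounded sequences have weakly convergent subsequences\<close>

text \<open>
  The sequence of distance vectors to a countable dense set lives in a product of countably many
  compact intervals, which is a compact metric space; this replaces an explicit diagonal argument.
  Since the distance functions are 1-Lipschitz, convergence passes from the dense set to all points.
\<close>

lemma bounded_subsequence_distances_converge:
  fixes f :: "nat \<Rightarrow> 'a::metric_space"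
  assumes sep: "separable_space (euclidean :: 'a topology)"
    and bd: "bounded (range f)"
  obtains r :: "nat \<Rightarrow> nat" where "strict_mono r" "\<And>y. convergent (\<lambda>n. dist (f (r n)) y)"
proof -
  obtain D :: "'a set" where D: "countable D" "\<And>x e. e > 0 \<Longrightarrow> \<exists>q\<in>D. dist x q < e"
    using separable_metric_dense_set[OF sep] by blast
  have "D \<noteq> {}" using D(2)[of 1] by fastforce
  define q where "q = from_nat_into D"
  have q: "range q = D" using \<open>D \<noteq> {}\<close> D(1) by (simp add: q_def)
  have "\<exists>B. \<forall>n. dist (f n) (q k) \<le> B" for k
    using bd unfolding bounded_any_center[of _ "q k"] by (auto simp: dist_commute)
  then obtain B where B: "\<And>k n. dist (f n) (q k) \<le> B k" by metis
  have "compactin (product_topology (\<lambda>_. euclidean) UNIV) (PiE UNIV (\<lambda>k. {0..B k}))"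
    unfolding compactin_PiE by auto
  then have "compact (PiE UNIV (\<lambda>k. {0..B k}))"
    by (simp add: euclidean_product_topology)
  then have "seq_compact (PiE UNIV (\<lambda>k. {0..B k}))"
    by (simp add: compact_eq_seq_compact_metric)
  moreover have "\<forall>n. (\<lambda>k. dist (f n) (q k)) \<in> PiE UNIV (\<lambda>k. {0..B k})"
    using B by auto
  ultimately obtain L r where r: "strict_mono r" "((\<lambda>n k. dist (f n) (q k)) \<circ> r) \<longlonglongrightarrow> L"
    by (rule seq_compactE)
  have lim: "(\<lambda>n. dist (f (r n)) (q k)) \<longlonglongrightarrow> L k" for k
    using continuous_on_tendsto_compose[OF continuous_on_product_coordinates r(2), of k]
    by (simp add: o_def)
  have "Cauchy (\<lambda>n. dist (f (r n)) y)" for y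
  proof (rule metric_CauchyI)
    fix e :: real assume "e > 0"
    then obtain k where k: "dist y (q k) < e / 3"
      using D(2)[of "e / 3" y] q by auto
    obtain N where N: "\<And>m n. m \<ge> N \<Longrightarrow> n \<ge> N \<Longrightarrow>
        dist (dist (f (r m)) (q k)) (dist (f (r n)) (q k)) < e / 3"
      using metric_CauchyD[OF LIMSEQ_imp_Cauchy[OF lim[of k]], of "e / 3"] \<open>e > 0\<close> by auto
    have near: "\<bar>dist (f (r n)) y - dist (f (r n)) (q k)\<bar> < e / 3" for n
      using k dist_triangle[of "f (r n)" y "q k"] dist_triangle[of "f (r n)" "q k" y]
      by (auto simp: dist_commute abs_if)
    have "dist (dist (f (r m)) y) (dist (f (r n)) y) < e" if "m \<ge> N" "n \<ge> N" for m n
      using near[of m] near[of n] N[OF that] unfolding dist_real_def by linarith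
    then show "\<exists>N. \<forall>m\<ge>N. \<forall>n\<ge>N. dist (dist (f (r m)) y) (dist (f (r n)) y) < e" by blast
  qed
  then have "convergent (\<lambda>n. dist (f (r n)) y)" for y
    by (intro Cauchy_convergent)
  then show ?thesis using that r(1) by blast
qed

text \<open>
  Existence and uniqueness of the asymptotic centre. The midpoint inequality survives the limit, so
  two points at which \<open>\<psi>\<^sup>2\<close> is almost minimal are close to each other. Applied to a minimising
  sequence this gives a Cauchy sequence, and applied to two minimisers it gives uniqueness.
\<close>

lemma limit_distance_strict_minimum:
  fixes x :: "nat \<Rightarrow> 'h::hadamard_space"
  assumes lim: "\<And>y. (\<lambda>n. dist (x n) y) \<longlonglongrightarrow> \<psi> y"
  obtains l where "\<And>y. y \<noteq> l \<Longrightarrow> \<psi> l < \<psi> y"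
proof -
  have nn: "0 \<le> \<psi> y" for y
    by (rule LIMSEQ_le_const[OF lim]) auto
  have lip: "\<psi> y \<le> \<psi> z + dist z y" for y z
    by (rule LIMSEQ_le[OF lim tendsto_add[OF lim[of z] tendsto_const]]) (auto simp: dist_triangle)
  have CN: "\<exists>m. (\<psi> m)\<^sup>2 \<le> (\<psi> y)\<^sup>2 / 2 + (\<psi> z)\<^sup>2 / 2 - (dist y z)\<^sup>2 / 4" for y z
  proof -
    obtain m where "\<And>w. (dist w m)\<^sup>2 \<le> (dist w y)\<^sup>2 / 2 + (dist w z)\<^sup>2 / 2 - (dist y z)\<^sup>2 / 4"
      using ex_midpoint_CN by blast
    then have "(\<psi> m)\<^sup>2 \<le> (\<psi> y)\<^sup>2 / 2 + (\<psi> z)\<^sup>2 / 2 - (dist y z)\<^sup>2 / 4"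
      by (intro LIMSEQ_le[of "\<lambda>n. (dist (x n) m)\<^sup>2"
            _ "\<lambda>n. (dist (x n) y)\<^sup>2 / 2 + (dist (x n) z)\<^sup>2 / 2 - (dist y z)\<^sup>2 / 4"]
          tendsto_intros lim) auto
    then show ?thesis by blast
  qed
  define I where "I = (INF y. (\<psi> y)\<^sup>2)"
  have bdd: "bdd_below (range (\<lambda>y. (\<psi> y)\<^sup>2))" by (rule bdd_belowI[of _ 0]) auto
  have I: "I \<le> (\<psi> y)\<^sup>2" for y unfolding I_def by (rule cINF_lower[OF bdd]) auto
  have gap: "(dist y z)\<^sup>2 \<le> 2 * ((\<psi> y)\<^sup>2 - I) + 2 * ((\<psi> z)\<^sup>2 - I)" for y z
  proof -
    obtain m where "(\<psi> m)\<^sup>2 \<le> (\<psi> y)\<^sup>2 / 2 + (\<psi> z)\<^sup>2 / 2 - (dist y z)\<^sup>2 / 4"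
      using CN by blast
    then have "I \<le> (\<psi> y)\<^sup>2 / 2 + (\<psi> z)\<^sup>2 / 2 - (dist y z)\<^sup>2 / 4"
      using I by (rule order.trans[rotated])
    then show ?thesis by (simp add: field_simps)
  qed
  have "\<exists>y. (\<psi> y)\<^sup>2 < I + 1 / real (Suc n)" for n
    using cINF_less_iff[OF _ bdd, of "I + 1 / real (Suc n)"] unfolding I_def by auto
  then obtain y where y: "\<And>n. (\<psi> (y n))\<^sup>2 < I + 1 / real (Suc n)" by metis
  have "Cauchy y"
  proof (rule metric_CauchyI)
    fix e :: real assume "e > 0"
    then obtain N where N: "1 / real (Suc N) < e\<^sup>2 / 4"
      using nat_approx_posE[of "e\<^sup>2 / 4"] by auto
    have small: "(\<psi> (y n))\<^sup>2 - I < e\<^sup>2 / 4" if "n \<ge> N" for n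
    proof -
      have "1 / real (Suc n) \<le> 1 / real (Suc N)" using that by (intro divide_left_mono) auto
      then show ?thesis using y[of n] N by linarith
    qed
    have "dist (y m) (y n) < e" if "m \<ge> N" "n \<ge> N" for m n
    proof (rule power2_less_imp_less)
      have "2 * ((\<psi> (y m))\<^sup>2 - I) + 2 * ((\<psi> (y n))\<^sup>2 - I) < 2 * (e\<^sup>2 / 4) + 2 * (e\<^sup>2 / 4)"
        using that by (intro add_strict_mono mult_strict_left_mono small) auto
      also have "\<dots> = e\<^sup>2" by simp
      finally show "(dist (y m) (y n))\<^sup>2 < e\<^sup>2"
        by (rule le_less_trans[OF gap])
    qed (use \<open>e > 0\<close> in simp)
    then show "\<exists>N. \<forall>m\<ge>N. \<forall>n\<ge>N. dist (y m) (y n) < e" by blast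
  qed
  then obtain l where l: "y \<longlonglongrightarrow> l"
    using Cauchy_convergent convergent_def by blast
  have "(\<lambda>n. \<psi> (y n)) \<longlonglongrightarrow> \<psi> l"
  proof (rule metric_tendsto_imp_tendsto[OF l])
    have "dist (\<psi> (y n)) (\<psi> l) \<le> dist (y n) l" for n
      using lip[of "y n" l] lip[of l "y n"] by (simp add: dist_real_def dist_commute abs_le_iff)
    then show "\<forall>\<^sub>F n in sequentially. dist (\<psi> (y n)) (\<psi> l) \<le> dist (y n) l" by simp
  qed
  moreover have "(\<lambda>n. I + 1 / real (Suc n)) \<longlonglongrightarrow> I"
    using tendsto_add[OF tendsto_const LIMSEQ_Suc[OF lim_1_over_n], of I] by simp
  ultimately have "(\<psi> l)\<^sup>2 \<le> I"
    using y by (intro LIMSEQ_le[OF tendsto_power]) (auto intro: less_imp_le)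
  then have "\<psi> l < \<psi> z" if "z \<noteq> l" for z
  proof -
    have "0 < (dist z l)\<^sup>2" using that by simp
    then have "(\<psi> l)\<^sup>2 < (\<psi> z)\<^sup>2" using gap[of z l] \<open>(\<psi> l)\<^sup>2 \<le> I\<close> by argo
    then show ?thesis using nn by (rule power2_less_imp_less)
  qed
  then show ?thesis using that by blast
qed

text \<open>
  If the projections to a geodesic from \<open>l\<close> did not tend to \<open>l\<close>, some subsequence of them would
  tend to a point \<open>p \<noteq> l\<close>. Along it, \<open>x n\<close> is asymptotically as close to \<open>p\<close> as to its own
  projection, hence at least as close as to \<open>l\<close>. But \<open>\<psi>\<close> is also the limit along the subsequence,
  and its minimum at \<open>l\<close> is strict.
\<close>

lemma weakly_converges_to_asymptotic_center:
  fixes x :: "nat \<Rightarrow> 'a::metric_space"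
  assumes lim: "\<And>y. (\<lambda>n. dist (x n) y) \<longlonglongrightarrow> \<psi> y"
    and min: "\<And>y. y \<noteq> l \<Longrightarrow> \<psi> l < \<psi> y"
  shows "weakly_converges x l"
  unfolding weakly_converges_def
proof
  fix g :: "real \<Rightarrow> 'a" assume g: "g \<in> geodesics_from l"
  let ?P = "\<lambda>n. geodesic_proj g (x n)"
  note geo = geodesics_fromD[OF g]
  have "seq_compact (g ` {0..1})"
    using compact_geodesic_image[OF geo(1)] by (simp add: compact_eq_seq_compact_metric)
  show "?P \<longlonglongrightarrow> l"
  proof (rule ccontr)
    assume "\<not> ?P \<longlonglongrightarrow> l"
    then obtain e where e: "e > 0" "\<not> (\<forall>\<^sub>F n in sequentially. dist (?P n) l < e)"
      unfolding tendsto_iff by blast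
    then have "\<exists>\<^sub>F n in sequentially. e \<le> dist (?P n) l"
      by (simp add: frequently_def not_le)
    then have "infinite {n. e \<le> dist (?P n) l}"
      by (simp add: frequently_cofinite flip: cofinite_eq_sequentially)
    then obtain s :: "nat \<Rightarrow> nat" where s: "strict_mono s" "\<And>n. e \<le> dist (?P (s n)) l"
      using infinite_enumerate by (metis mem_Collect_eq)
    have "\<forall>n. ?P (s n) \<in> g ` {0..1}" using geodesic_proj_nearest(1)[OF geo(1)] by blast
    then obtain p t where t: "strict_mono t" "((\<lambda>n. ?P (s n)) \<circ> t) \<longlonglongrightarrow> p"
      using seq_compactE[OF \<open>seq_compact (g ` {0..1})\<close>] by metis
    define u where "u = s \<circ> t"
    have u: "strict_mono u" using s(1) t(1) by (simp add: u_def strict_mono_o)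
    have P: "(\<lambda>n. ?P (u n)) \<longlonglongrightarrow> p" using t(2) by (simp add: u_def o_def)
    have lim_u: "(\<lambda>n. dist (x (u n)) y) \<longlonglongrightarrow> \<psi> y" for y
      using LIMSEQ_subseq_LIMSEQ[OF lim u] by (simp add: o_def)
    have "e \<le> dist p l"
      by (rule LIMSEQ_le_const[OF tendsto_dist[OF P tendsto_const]]) (auto simp: u_def s(2))
    then have "p \<noteq> l" using e(1) by auto
    have "dist (x (u n)) p \<le> dist (x (u n)) l + dist (?P (u n)) p" for n
      using geodesic_proj_nearest(2)[OF geo(1) geo(2), of "x (u n)"]
        dist_triangle[of "x (u n)" p "?P (u n)"] by linarith
    moreover have "(\<lambda>n. dist (x (u n)) l + dist (?P (u n)) p) \<longlonglongrightarrow> \<psi> l + dist p p"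
      by (intro tendsto_intros lim_u P)
    ultimately have "\<psi> p \<le> \<psi> l"
      using LIMSEQ_le[OF lim_u[of p]] by fastforce
    then show False using min[OF \<open>p \<noteq> l\<close>] by simp
  qed
qed

lemma bounded_imp_weakly_convergent_subsequence:
  fixes f :: "nat \<Rightarrow> 'h::hadamard_space"
  assumes "separable_space (euclidean :: 'h topology)" "bounded (range f)"
  obtains l r where "strict_mono (r :: nat \<Rightarrow> nat)" "weakly_converges (f \<circ> r) l"
proof -
  obtain r :: "nat \<Rightarrow> nat" where r: "strict_mono r" "\<And>y. convergent (\<lambda>n. dist (f (r n)) y)"
    using bounded_subsequence_distances_converge[OF assms] by blast
  then obtain \<psi> where \<psi>: "\<And>y. (\<lambda>n. dist ((f \<circ> r) n) y) \<longlonglongrightarrow> \<psi> y"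
    unfolding convergent_def o_def by metis
  obtain l where "\<And>y. y \<noteq> l \<Longrightarrow> \<psi> l < \<psi> y"
    using limit_distance_strict_minimum[OF \<psi>] by blast
  then show ?thesis
    using that r(1) weakly_converges_to_asymptotic_center[OF \<psi>] by blast
qed

section \<open>Weak compactness and weak sequential compactness\<close>

theorem corollary3:
  fixes K :: "'h::hadamard_space set"
  assumes "separable_space (euclidean :: 'h topology)"
    and "Hausdorff_space (weak_topology :: 'h topology)"
    and "bounded K"
  shows "compactin weak_topology K \<longleftrightarrow> weakly_seq_compact K"
proof
  assume "compactin weak_topology K"
  then have "closedin weak_topology K" by (rule compactin_imp_closedin[OF assms(2)])
  then have co: "weakly_open (- K)" by (simp add: closedin_def flip: Compl_eq_Diff_UNIV)
  show "weakly_seq_compact K"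
    unfolding weakly_seq_compact_def
  proof (intro allI impI)
    fix f :: "nat \<Rightarrow> 'h" assume f: "range f \<subseteq> K"
    obtain l r where r: "strict_mono r" "weakly_converges (f \<circ> r) l"
      using bounded_imp_weakly_convergent_subsequence[OF assms(1) bounded_subset[OF assms(3) f]]
      by blast
    have "l \<in> K"
    proof (rule ccontr)
      assume "l \<notin> K"
      then have "\<forall>\<^sub>F n in sequentially. (f \<circ> r) n \<in> - K"
        using weakly_converges_eventually_in[OF r(2) co] by simp
      then obtain n where "f (r n) \<in> - K"
        using eventually_happens'[OF sequentially_bot] by fastforce
      then show False using f by blast
    qed
    then show "\<exists>l\<in>K. \<exists>r. strict_mono r \<and> weakly_converges (f \<circ> r) l" using r by blast
  qed
next
  assume "weakly_seq_compact K"
  then show "compactin weak_topology K"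
    by (rule weakly_seq_compact_imp_compactin[OF assms(1)])
qed

end
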